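(* Let $A=M+K$ be $n\times n$ real matrices with $A$ and $M$ invertible, let $b\in\mathbb{R}^n$, $b\neq 0$, and let $Ax=b$. Put $B:=I+M^{-1}K$ and $c:=M^{-1}b$. Assume that there is an inverse-equivalent algorithm for inverting $M$ so that the computed results of $B$ and $c$, denoted by $\widehat B$ and $\hat c$ respectively, satisfy $$\widehat B=B+E\quad\text{with}\quad\|E\|\le\mathcal{O}(\mathbf{u})\,(1+\|M^{-1}\|\|K\|),\qquad \|\hat c-c\|\le\mathcal{O}(\mathbf{u})\,\|M^{-1}\|\|b\|.$$ Let $\hat x$ be the computed solution to $\widehat Bx=\hat c$ by a backward stable algorithm, so that $\hat x$ satisfies $$(\widehat B+F)\hat x=\hat c\quad\text{with}\quad\frac{\|F\|}{\|\widehat B\|}\le\mathcal{O}(\mathbf{u}).$$ Let $\delta:=(\|E\|+\|F\|)\|B^{-1}\|$ and assume that $\delta<1$. Then $$\frac{\|\hat x-x\|}{\|A^{-1}\|\|b\|}\le\mathcal{O}(\mathbf{u})\,\frac{\kappa(B)}{1-\delta}\left(4+\frac{\|K\|\|x\|}{\|b\|}\right).$$ In particular, if $\|M^{-1}\|\|K\|<1$, then $$\frac{\|\hat x-x\|}{\|A^{-1}\|\|b\|}\le\frac{\mathcal{O}(\mathbf{u})}{(1-\delta)(1-\|M^{-1}\|\|K\|)^2}.$$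
   Context: Norms: $\|\cdot\|$ denotes a general norm for vectors on $\mathbb{R}^n$ and its induced operator norm for matrices; $\kappa(B)=\|B\|\|B^{-1}\|$. Order notation: $\mathbf{u}$ ($0<\mathbf{u}<1$) is the machine roundoff unit, and $\mathcal{O}(\mathbf{u})$ denotes a term bounded by $p(n)\mathbf{u}$ for some polynomial $p(n)$ in $n$. Different occurrences may involve different polynomials; the polynomials in the conclusions depend only on those in the hypotheses, not on the particular matrices and vectors. Definition: given an invertible $M$, an algorithm for solving linear systems with coefficient matrix $M$ is inverse-equivalent if, for any right-hand side $d$, it produces in floating point arithmetic a computed solution $\hat y$ to $My=d$ such that $\|\hat y-y\|\le\mathcal{O}(\mathbf{u})\|M^{-1}\|\|d\|$, where $y=M^{-1}d$. In the theorem this algorithm enters only through the stated bounds on $E=\widehat B-B$ and $\hat c-c$. *)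

theory Defs
  imports
    "HOL-Computational_Algebra.Polynomial"
    "Jordan_Normal_Form.Matrix"
    "Jordan_Normal_Form.Gauss_Jordan_Elimination"
begin

(* The order n is an explicit carrier index rather than a type, so that a polynomial in n can be
   chosen before n is quantified. *)

definition is_vec_norm :: "nat \<Rightarrow> (real Matrix.vec \<Rightarrow> real) \<Rightarrow> bool" where
  "is_vec_norm n N \<longleftrightarrow>
     (\<forall>v \<in> carrier_vec n. 0 \<le> N v \<and> (N v = 0 \<longleftrightarrow> v = 0\<^sub>v n)) \<and>
     (\<forall>a. \<forall>v \<in> carrier_vec n. N (a \<cdot>\<^sub>v v) = \<bar>a\<bar> * N v) \<and>
     (\<forall>v \<in> carrier_vec n. \<forall>w \<in> carrier_vec n. N (v + w) \<le> N v + N w)"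

(* For n > 0 the supremum is over a nonempty set, bounded because the dimension is finite. *)

definition op_norm :: "nat \<Rightarrow> (real Matrix.vec \<Rightarrow> real) \<Rightarrow> real Matrix.mat \<Rightarrow> real" where
  "op_norm n N A = (SUP v \<in> carrier_vec n - {0\<^sub>v n}. N (A *\<^sub>v v) / N v)"

(* Unspecified on singular matrices; lemma mat_inv below gives the value on invertible ones. *)

definition mat_inv :: "real Matrix.mat \<Rightarrow> real Matrix.mat" where
  "mat_inv A = the (mat_inverse A)"

definition cond_num :: "nat \<Rightarrow> (real Matrix.vec \<Rightarrow> real) \<Rightarrow> real Matrix.mat \<Rightarrow> real" where
  "cond_num n N B = op_norm n N B * op_norm n N (mat_inv B)"

(* A quantity is O(u) with polynomial p if it is at most Ou p n u. *)

definition Ou :: "real poly \<Rightarrow> nat \<Rightarrow> real \<Rightarrow> real" where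
  "Ou p n u = poly p (real n) * u"

lemma mat_inv:
  assumes A: "A \<in> carrier_mat n n" and inv: "invertible_mat A"
  shows "mat_inv A \<in> carrier_mat n n" "A * mat_inv A = 1\<^sub>m n" "mat_inv A * A = 1\<^sub>m n"
proof -
  from inv obtain C where C: "A * C = 1\<^sub>m n" "C * A = 1\<^sub>m (dim_row C)"
    using A unfolding invertible_mat_def inverts_mat_def by auto
  have "dim_col (A * C) = n" "dim_col (C * A) = dim_row C"
    using C by auto
  then have "C \<in> carrier_mat n n" using A by auto
  then have "A \<in> Units (ring_mat TYPE(real) n ())"
    using A C unfolding Units_def ring_mat_def by auto
  then obtain D where "mat_inverse A = Some D"
    using mat_inverse(1)[OF A, where b = "()"] by (cases "mat_inverse A") auto
  then show "mat_inv A \<in> carrier_mat n n" "A * mat_inv A = 1\<^sub>m n" "mat_inv A * A = 1\<^sub>m n"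
    using mat_inverse(2)[OF A] unfolding mat_inv_def by auto
qed

end

theory Submission
  imports Defs "HOL-Analysis.Elementary_Metric_Spaces"
begin

text \<open>
  Since \<open>B = M\<^sup>-\<^sup>1 A\<close>, the exact solution satisfies \<open>B x = c\<close>, and the computed vector satisfies the
  perturbed system \<open>(B + E + F) xh = ch\<close>. Writing \<open>e = xh - x\<close> and \<open>G = E + F\<close>, subtraction gives
  \<open>B e = (ch - c) - G x - G e\<close>, and absorbing the last term on the left yields
  \<open>(1 - \<delta>) \<parallel>e\<parallel> \<le> \<parallel>B\<^sup>-\<^sup>1\<parallel> (\<parallel>ch - c\<parallel> + \<parallel>G\<parallel> \<parallel>x\<parallel>)\<close> (lemma \<open>perturbed_solution_bound\<close>).

  It remains to see that every error source is \<open>O(u)\<close> times \<open>\<parallel>B\<parallel> \<parallel>A\<^sup>-\<^sup>1\<parallel> \<parallel>b\<parallel> (4 + \<parallel>K\<parallel> \<parallel>x\<parallel> / \<parallel>b\<parallel>)\<close>, because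
  then only the condition number of \<open>B\<close> appears and not that of \<open>M\<close>. The identity \<open>M\<^sup>-\<^sup>1 = B A\<^sup>-\<^sup>1\<close> trades
  \<open>\<parallel>M\<^sup>-\<^sup>1\<parallel>\<close> for \<open>\<parallel>B\<parallel> \<parallel>A\<^sup>-\<^sup>1\<parallel>\<close>. The constant 1 in the bound on \<open>E\<close> is traded by
  \<open>1 = \<parallel>B - M\<^sup>-\<^sup>1 K\<parallel> \<le> \<parallel>B\<parallel> + \<parallel>M\<^sup>-\<^sup>1\<parallel> \<parallel>K\<parallel>\<close>, and the remaining product with \<open>\<parallel>K\<parallel> \<parallel>x\<parallel>\<close> is what the term
  \<open>\<parallel>K\<parallel> \<parallel>x\<parallel> / \<parallel>b\<parallel>\<close> of the conclusion accounts for. Finally \<open>\<delta> < 1\<close> forces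
  \<open>\<parallel>E\<parallel> \<parallel>B\<^sup>-\<^sup>1\<parallel> < 1 \<le> \<parallel>B\<parallel> \<parallel>B\<^sup>-\<^sup>1\<parallel>\<close>, hence \<open>\<parallel>B + E\<parallel> \<le> 2 \<parallel>B\<parallel>\<close>, which controls \<open>F\<close>.

  If \<open>\<mu> = \<parallel>M\<^sup>-\<^sup>1\<parallel> \<parallel>K\<parallel> < 1\<close>, then \<open>\<parallel>B\<parallel> \<le> 2\<close> and, by the Neumann estimate, \<open>\<parallel>B\<^sup>-\<^sup>1\<parallel> \<le> 1 / (1 - \<mu>)\<close>;
  together with \<open>A\<^sup>-\<^sup>1 = B\<^sup>-\<^sup>1 M\<^sup>-\<^sup>1\<close> this bounds \<open>\<parallel>K\<parallel> \<parallel>x\<parallel> / \<parallel>b\<parallel>\<close> by \<open>\<mu> / (1 - \<mu>)\<close>, and both factors of the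
  first estimate become explicit in \<open>\<mu>\<close>.

  All of this manipulates operator norms, which are suprema and obey the usual rules only when they
  are finite. Finiteness is the one analytic ingredient: an arbitrary norm dominates the
  coordinate sum, by compactness of bounded sets in finite dimension (lemma
  \<open>norm_dominates_coordinate_sum\<close>).
\<close>

section \<open>Norms on a finite-dimensional coordinate space\<close>

lemma vec_norm_nonneg: "is_vec_norm n N \<Longrightarrow> v \<in> carrier_vec n \<Longrightarrow> 0 \<le> N v"
  unfolding is_vec_norm_def by blast

lemma vec_norm_zero: "is_vec_norm n N \<Longrightarrow> N (0\<^sub>v n) = 0"
  unfolding is_vec_norm_def by auto

lemma vec_norm_pos: "is_vec_norm n N \<Longrightarrow> v \<in> carrier_vec n \<Longrightarrow> v \<noteq> 0\<^sub>v n \<Longrightarrow> 0 < N v"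
  unfolding is_vec_norm_def by (simp add: order_less_le)

lemma vec_norm_smult: "is_vec_norm n N \<Longrightarrow> v \<in> carrier_vec n \<Longrightarrow> N (a \<cdot>\<^sub>v v) = \<bar>a\<bar> * N v"
  unfolding is_vec_norm_def by blast

lemma vec_norm_triangle:
  "is_vec_norm n N \<Longrightarrow> v \<in> carrier_vec n \<Longrightarrow> w \<in> carrier_vec n \<Longrightarrow> N (v + w) \<le> N v + N w"
  unfolding is_vec_norm_def by blast

lemma vec_norm_diff_triangle:
  assumes N: "is_vec_norm n N" and v: "v \<in> carrier_vec n" and w: "w \<in> carrier_vec n"
  shows "N (v - w) \<le> N v + N w"
proof -
  have "N ((-1) \<cdot>\<^sub>v w) = \<bar>-1\<bar> * N w"
    using vec_norm_smult[OF N w] .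
  moreover have "v - w = v + (-1) \<cdot>\<^sub>v w"
    using v w by (intro eq_vecI) auto
  moreover have "N (v + (-1) \<cdot>\<^sub>v w) \<le> N v + N ((-1) \<cdot>\<^sub>v w)"
    using v w by (intro vec_norm_triangle[OF N]) auto
  ultimately show ?thesis by simp
qed

text \<open>Expanding a vector in the unit vectors one coordinate at a time; \<open>k\<close> counts the coordinates
  already kept.\<close>

lemma vec_norm_truncation_le:
  assumes N: "is_vec_norm n N" and v: "v \<in> carrier_vec n"
  shows "k \<le> n \<Longrightarrow> N (Matrix.vec n (\<lambda>i. if i < k then v $ i else 0))
           \<le> (\<Sum>i<k. \<bar>v $ i\<bar> * N (unit_vec n i))"
proof (induction k)
  case 0
  have "Matrix.vec n (\<lambda>i. if i < 0 then v $ i else 0) = 0\<^sub>v n" by auto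
  moreover have "N (0\<^sub>v n) = 0" by (rule vec_norm_zero[OF N])
  ultimately show ?case by simp
next
  case (Suc k)
  let ?t = "\<lambda>k. Matrix.vec n (\<lambda>i. if i < k then v $ i else 0)"
  have "?t (Suc k) = ?t k + (v $ k) \<cdot>\<^sub>v unit_vec n k"
    using Suc.prems by (intro eq_vecI) (auto simp: less_Suc_eq)
  moreover have "N (?t k + (v $ k) \<cdot>\<^sub>v unit_vec n k) \<le> N (?t k) + N ((v $ k) \<cdot>\<^sub>v unit_vec n k)"
    by (intro vec_norm_triangle[OF N]) auto
  moreover have "N ((v $ k) \<cdot>\<^sub>v unit_vec n k) = \<bar>v $ k\<bar> * N (unit_vec n k)"
    by (intro vec_norm_smult[OF N]) auto
  ultimately show ?case using Suc by simp
qed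

lemma vec_norm_le_coordinate_sum:
  assumes N: "is_vec_norm n N"
  obtains C where "0 \<le> C" "\<And>v. v \<in> carrier_vec n \<Longrightarrow> N v \<le> C * (\<Sum>i<n. \<bar>v $ i\<bar>)"
proof
  define C where "C = (\<Sum>i<n. N (unit_vec n i))"
  have N0: "0 \<le> N (unit_vec n i)" for i
    by (intro vec_norm_nonneg[OF N]) auto
  show "0 \<le> C" unfolding C_def by (simp add: N0 sum_nonneg)
  fix v :: "real Matrix.vec" assume v: "v \<in> carrier_vec n"
  have "Matrix.vec n (\<lambda>i. if i < n then v $ i else 0) = v"
    using v by (intro eq_vecI) auto
  then have "N v \<le> (\<Sum>i<n. \<bar>v $ i\<bar> * N (unit_vec n i))"
    using vec_norm_truncation_le[OF N v, of n] by simp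
  also have "\<dots> \<le> (\<Sum>i<n. \<bar>v $ i\<bar> * C)"
    unfolding C_def by (intro sum_mono mult_left_mono member_le_sum) (auto simp: N0)
  also have "\<dots> = C * (\<Sum>i<n. \<bar>v $ i\<bar>)" by (simp add: sum_distrib_left mult.commute)
  finally show "N v \<le> C * (\<Sum>i<n. \<bar>v $ i\<bar>)" .
qed

text \<open>Otherwise there are vectors with coordinate sum 1 and norm tending to 0. By
  Bolzano-Weierstrass a subsequence converges coordinatewise; its limit still has coordinate sum 1,
  but norm 0 because the norm is continuous by the upper bound above.\<close>

lemma norm_dominates_coordinate_sum:
  assumes N: "is_vec_norm n N"
  obtains D where "0 \<le> D" "\<And>v. v \<in> carrier_vec n \<Longrightarrow> (\<Sum>i<n. \<bar>v $ i\<bar>) \<le> D * N v"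
proof (rule ccontr)
  assume no: "\<not> thesis"
  define s where "s = (\<lambda>v :: real Matrix.vec. \<Sum>i<n. \<bar>v $ i\<bar>)"
  have N0: "0 \<le> N v" if "v \<in> carrier_vec n" for v
    using vec_norm_nonneg[OF N that] .
  have "\<exists>v \<in> carrier_vec n. real (Suc k) * N v < s v" for k
  proof (rule ccontr)
    assume "\<not> ?thesis"
    then have "\<And>v. v \<in> carrier_vec n \<Longrightarrow> (\<Sum>i<n. \<bar>v $ i\<bar>) \<le> real (Suc k) * N v"
      unfolding s_def by (meson not_less)
    then show False using no that[of "real (Suc k)"] by simp
  qed
  then obtain v where v: "\<And>k. v k \<in> carrier_vec n" and vs: "\<And>k. real (Suc k) * N (v k) < s (v k)"
    by metis
  have s_pos: "0 < s (v k)" for k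
    by (rule le_less_trans[OF _ vs]) (simp add: N0[OF v])
  define w where "w = (\<lambda>k. (1 / s (v k)) \<cdot>\<^sub>v v k)"
  have w: "w k \<in> carrier_vec n" for k unfolding w_def using v by simp
  have ws: "s (w k) = 1" for k
  proof -
    have "s (w k) = (\<Sum>i<n. \<bar>v k $ i\<bar> / s (v k))"
      unfolding s_def[of] w_def using v[of k] s_pos[of k]
      by (intro sum.cong) (auto simp: abs_mult s_def)
    also have "\<dots> = s (v k) / s (v k)"
      unfolding sum_divide_distrib[symmetric] by (simp add: s_def)
    finally show ?thesis using s_pos[of k] by simp
  qed
  have wN: "N (w k) \<le> inverse (real (Suc k))" for k
  proof -
    have "N (w k) = \<bar>1 / s (v k)\<bar> * N (v k)"
      unfolding w_def using vec_norm_smult[OF N v] .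
    also have "\<dots> = N (v k) / s (v k)" using s_pos[of k] by simp
    also have "\<dots> \<le> inverse (real (Suc k))"
      using vs[of k] s_pos[of k] by (simp add: divide_simps mult.commute)
    finally show ?thesis .
  qed
  have w_bound: "\<bar>w k $ i\<bar> \<le> 1" if "i < n" for i k
  proof -
    have "\<bar>w k $ i\<bar> \<le> s (w k)"
      unfolding s_def by (rule member_le_sum[of i "{..<n}" "\<lambda>i. \<bar>w k $ i\<bar>"]) (use that in auto)
    then show ?thesis by (simp add: ws)
  qed
  have "\<forall>\<delta>\<subseteq>{..<n}. \<exists>l::nat \<Rightarrow> real. \<exists>r. strict_mono r \<and>
      (\<forall>e>0. \<forall>\<^sub>F k in sequentially. \<forall>i\<in>\<delta>. dist (w (r k) $ i) (l i) < e)"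
  proof (rule compact_lemma_general
      [where f = "\<lambda>k i. w k $ i" and proj = "\<lambda>x i. x i" and unproj = "\<lambda>x. x"])
    fix i assume "i \<in> {..<n}"
    then show "bounded ((\<lambda>x. x i) ` range (\<lambda>k i. w k $ i))"
      unfolding bounded_iff by (intro exI[of _ 1]) (auto simp: w_bound)
  qed auto
  then obtain l r where r: "strict_mono r"
    and ev: "\<And>e. e > 0 \<Longrightarrow> \<forall>\<^sub>F k in sequentially. \<forall>i\<in>{..<n}. dist (w (r k) $ i) (l i) < e"
    by blast
  have lim: "(\<lambda>k. w (r k) $ i) \<longlonglongrightarrow> l i" if "i < n" for i
    unfolding tendsto_iff using that by (auto intro: eventually_mono[OF ev])
  define L where "L = Matrix.vec n l"
  have L: "L \<in> carrier_vec n" unfolding L_def by simp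
  have "(\<lambda>k. s (w (r k))) \<longlonglongrightarrow> s L"
    unfolding s_def by (intro tendsto_sum tendsto_rabs) (auto simp: L_def lim)
  then have sL: "s L = 1" using LIMSEQ_unique[OF tendsto_const, of 1] by (simp add: ws)
  obtain C where C: "0 \<le> C" "\<And>v. v \<in> carrier_vec n \<Longrightarrow> N v \<le> C * (\<Sum>i<n. \<bar>v $ i\<bar>)"
    using vec_norm_le_coordinate_sum[OF N] by blast
  have upper: "N L \<le> inverse (real (Suc (r k))) + C * (\<Sum>i<n. \<bar>l i - w (r k) $ i\<bar>)" for k
  proof -
    have d: "L - w (r k) \<in> carrier_vec n" using L w by simp
    have "L = w (r k) + (L - w (r k))" using L w[of "r k"] by (intro eq_vecI) auto
    then have "N L \<le> N (w (r k)) + N (L - w (r k))"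
      using vec_norm_triangle[OF N w[of "r k"] d] by simp
    moreover have "N (L - w (r k)) \<le> C * (\<Sum>i<n. \<bar>(L - w (r k)) $ i\<bar>)" by (rule C(2)[OF d])
    moreover have "(\<Sum>i<n. \<bar>(L - w (r k)) $ i\<bar>) = (\<Sum>i<n. \<bar>l i - w (r k) $ i\<bar>)"
      using w[of "r k"] by (intro sum.cong) (auto simp: L_def)
    ultimately show ?thesis using wN[of "r k"] by simp
  qed
  have "(\<lambda>k. inverse (real (Suc (r k)))) \<longlonglongrightarrow> 0"
    using LIMSEQ_subseq_LIMSEQ[OF LIMSEQ_inverse_real_of_nat r] by (simp add: o_def)
  moreover have "(\<lambda>k. \<Sum>i<n. \<bar>l i - w (r k) $ i\<bar>) \<longlonglongrightarrow> (\<Sum>i<n. \<bar>l i - l i\<bar>)"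
    by (intro tendsto_sum tendsto_rabs tendsto_diff tendsto_const) (auto simp: lim)
  ultimately have
    "(\<lambda>k. inverse (real (Suc (r k))) + C * (\<Sum>i<n. \<bar>l i - w (r k) $ i\<bar>)) \<longlonglongrightarrow> 0 + C * (\<Sum>i<n. \<bar>l i - l i\<bar>)"
    by (intro tendsto_add tendsto_mult tendsto_const)
  then have "N L \<le> 0 + C * (\<Sum>i<n. \<bar>l i - l i\<bar>)"
    by (rule LIMSEQ_le_const) (use upper in blast)
  then have "N L = 0" using N0[OF L] by simp
  then have "L = 0\<^sub>v n" using vec_norm_pos[OF N L] by force
  then have "s L = 0" unfolding s_def by simp
  then show False using sL by simp
qed

section \<open>Operator norms\<close>

lemma mat_vec_norm_bounded:
  assumes N: "is_vec_norm n N" and A: "A \<in> carrier_mat n n"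
  obtains C where "\<And>v. v \<in> carrier_vec n \<Longrightarrow> N (A *\<^sub>v v) \<le> C * N v"
proof -
  obtain C where C: "0 \<le> C" "\<And>v. v \<in> carrier_vec n \<Longrightarrow> N v \<le> C * (\<Sum>i<n. \<bar>v $ i\<bar>)"
    using vec_norm_le_coordinate_sum[OF N] by blast
  obtain D where D: "0 \<le> D" "\<And>v. v \<in> carrier_vec n \<Longrightarrow> (\<Sum>i<n. \<bar>v $ i\<bar>) \<le> D * N v"
    using norm_dominates_coordinate_sum[OF N] by blast
  define S where "S = (\<Sum>i<n. \<Sum>j<n. \<bar>A $$ (i,j)\<bar>)"
  have "N (A *\<^sub>v v) \<le> (C * (S * D)) * N v" if v: "v \<in> carrier_vec n" for v
  proof -
    have vj: "\<bar>v $ j\<bar> \<le> D * N v" if "j < n" for j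
      using member_le_sum[of j "{..<n}" "\<lambda>j. \<bar>v $ j\<bar>"] D(2)[OF v] that by force
    have "\<bar>(A *\<^sub>v v) $ i\<bar> \<le> (\<Sum>j<n. \<bar>A $$ (i,j)\<bar> * (D * N v))" if i: "i < n" for i
    proof -
      have "(A *\<^sub>v v) $ i = (\<Sum>j<n. A $$ (i,j) * v $ j)"
        using A v i by (auto simp: scalar_prod_def lessThan_atLeast0 intro!: sum.cong)
      then have "\<bar>(A *\<^sub>v v) $ i\<bar> \<le> (\<Sum>j<n. \<bar>A $$ (i,j)\<bar> * \<bar>v $ j\<bar>)"
        using sum_abs[of "\<lambda>j. A $$ (i,j) * v $ j" "{..<n}"] by (simp add: abs_mult)
      also have "\<dots> \<le> (\<Sum>j<n. \<bar>A $$ (i,j)\<bar> * (D * N v))"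
        by (intro sum_mono mult_left_mono) (auto simp: vj)
      finally show ?thesis .
    qed
    then have "(\<Sum>i<n. \<bar>(A *\<^sub>v v) $ i\<bar>) \<le> (\<Sum>i<n. \<Sum>j<n. \<bar>A $$ (i,j)\<bar> * (D * N v))"
      by (intro sum_mono) auto
    also have "\<dots> = S * (D * N v)" unfolding S_def by (simp add: sum_distrib_right)
    finally have "C * (\<Sum>i<n. \<bar>(A *\<^sub>v v) $ i\<bar>) \<le> C * (S * (D * N v))"
      using C(1) by (rule mult_left_mono)
    moreover have "A *\<^sub>v v \<in> carrier_vec n" using A v by simp
    ultimately show ?thesis using C(2) by (force simp: mult.assoc)
  qed
  then show thesis by (rule that)
qed

lemma op_norm_bound:
  assumes N: "is_vec_norm n N" and A: "A \<in> carrier_mat n n" and v: "v \<in> carrier_vec n"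
  shows "N (A *\<^sub>v v) \<le> op_norm n N A * N v"
proof (cases "v = 0\<^sub>v n")
  case True
  have "A *\<^sub>v 0\<^sub>v n = 0\<^sub>v n" using A by (intro eq_vecI) auto
  moreover have "N (0\<^sub>v n) = 0" by (rule vec_norm_zero[OF N])
  ultimately show ?thesis using True by simp
next
  case False
  have pos: "0 < N w" if "w \<in> carrier_vec n - {0\<^sub>v n}" for w
    using vec_norm_pos[OF N] that by blast
  obtain C where C: "\<And>v. v \<in> carrier_vec n \<Longrightarrow> N (A *\<^sub>v v) \<le> C * N v"
    using mat_vec_norm_bounded[OF N A] by blast
  have "bdd_above ((\<lambda>v. N (A *\<^sub>v v) / N v) ` (carrier_vec n - {0\<^sub>v n}))"
    by (rule bdd_aboveI2[of _ _ C]) (use C pos in \<open>simp add: divide_le_eq\<close>)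
  then have "N (A *\<^sub>v v) / N v \<le> op_norm n N A"
    unfolding op_norm_def by (rule cSUP_upper[rotated]) (use v False in simp)
  then show ?thesis using pos[of v] v False by (simp add: divide_le_eq)
qed

text \<open>In dimension 0 the supremum ranges over the empty set and its value is arbitrary; hence the
  hypothesis \<open>0 < n\<close> in this and the following rules.\<close>

lemma op_norm_least:
  assumes N: "is_vec_norm n N" and n: "0 < n"
    and C: "\<And>v. v \<in> carrier_vec n \<Longrightarrow> N (A *\<^sub>v v) \<le> C * N v"
  shows "op_norm n N A \<le> C"
  unfolding op_norm_def
proof (rule cSUP_least)
  have "unit_vec n 0 \<in> carrier_vec n - {0\<^sub>v n}"
    using n by (simp add: unit_vec_nonzero)
  then show "carrier_vec n - {0\<^sub>v n} \<noteq> ({} :: real Matrix.vec set)" by blast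
next
  fix v :: "real Matrix.vec" assume v: "v \<in> carrier_vec n - {0\<^sub>v n}"
  then have "0 < N v"
    using vec_norm_pos[OF N] by blast
  then show "N (A *\<^sub>v v) / N v \<le> C" using C[of v] v by (simp add: divide_le_eq)
qed

lemma op_norm_nonneg:
  assumes N: "is_vec_norm n N" and n: "0 < n" and A: "A \<in> carrier_mat n n"
  shows "0 \<le> op_norm n N A"
proof -
  let ?e = "unit_vec n 0 :: real Matrix.vec"
  have "?e \<noteq> 0\<^sub>v n" using n by (simp add: unit_vec_nonzero)
  then have e: "0 < N ?e"
    using vec_norm_pos[OF N unit_vec_carrier] by blast
  have "A *\<^sub>v ?e \<in> carrier_vec n" using A by simp
  then have "0 \<le> N (A *\<^sub>v ?e)" by (rule vec_norm_nonneg[OF N])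
  also have "\<dots> \<le> op_norm n N A * N ?e" by (rule op_norm_bound[OF N A]) simp
  finally show ?thesis using e by (simp add: zero_le_mult_iff)
qed

lemma op_norm_add_le:
  assumes N: "is_vec_norm n N" and n: "0 < n" and A: "A \<in> carrier_mat n n" and B: "B \<in> carrier_mat n n"
  shows "op_norm n N (A + B) \<le> op_norm n N A + op_norm n N B"
proof (rule op_norm_least[OF N n])
  fix v :: "real Matrix.vec" assume v: "v \<in> carrier_vec n"
  have "(A + B) *\<^sub>v v = A *\<^sub>v v + B *\<^sub>v v" by (rule add_mult_distrib_mat_vec[OF A B v])
  moreover have "N (A *\<^sub>v v + B *\<^sub>v v) \<le> N (A *\<^sub>v v) + N (B *\<^sub>v v)"
    using A B v by (intro vec_norm_triangle[OF N]) auto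
  ultimately show "N ((A + B) *\<^sub>v v) \<le> (op_norm n N A + op_norm n N B) * N v"
    using op_norm_bound[OF N A v] op_norm_bound[OF N B v] by (simp add: distrib_right)
qed

lemma op_norm_diff_le:
  assumes N: "is_vec_norm n N" and n: "0 < n" and A: "A \<in> carrier_mat n n" and B: "B \<in> carrier_mat n n"
  shows "op_norm n N (A - B) \<le> op_norm n N A + op_norm n N B"
proof (rule op_norm_least[OF N n])
  fix v :: "real Matrix.vec" assume v: "v \<in> carrier_vec n"
  have "(A - B) *\<^sub>v v = A *\<^sub>v v - B *\<^sub>v v" by (rule minus_mult_distrib_mat_vec[OF A B v])
  moreover have "N (A *\<^sub>v v - B *\<^sub>v v) \<le> N (A *\<^sub>v v) + N (B *\<^sub>v v)"
    using A B v by (intro vec_norm_diff_triangle[OF N]) auto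
  ultimately show "N ((A - B) *\<^sub>v v) \<le> (op_norm n N A + op_norm n N B) * N v"
    using op_norm_bound[OF N A v] op_norm_bound[OF N B v] by (simp add: distrib_right)
qed

lemma op_norm_mult_le:
  assumes N: "is_vec_norm n N" and n: "0 < n" and A: "A \<in> carrier_mat n n" and B: "B \<in> carrier_mat n n"
  shows "op_norm n N (A * B) \<le> op_norm n N A * op_norm n N B"
proof (rule op_norm_least[OF N n])
  fix v :: "real Matrix.vec" assume v: "v \<in> carrier_vec n"
  have "N ((A * B) *\<^sub>v v) = N (A *\<^sub>v (B *\<^sub>v v))" using A B v by simp
  also have "\<dots> \<le> op_norm n N A * N (B *\<^sub>v v)" using op_norm_bound[OF N A] B v by simp
  also have "\<dots> \<le> op_norm n N A * (op_norm n N B * N v)"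
    by (intro mult_left_mono op_norm_bound[OF N B v] op_norm_nonneg[OF N n A])
  finally show "N ((A * B) *\<^sub>v v) \<le> op_norm n N A * op_norm n N B * N v" by (simp add: mult.assoc)
qed

lemma op_norm_one_ge:
  assumes N: "is_vec_norm n N" and n: "0 < n"
  shows "1 \<le> op_norm n N (1\<^sub>m n)"
proof -
  let ?e = "unit_vec n 0 :: real Matrix.vec"
  have "?e \<noteq> 0\<^sub>v n" using n by (simp add: unit_vec_nonzero)
  then have "0 < N ?e"
    using vec_norm_pos[OF N unit_vec_carrier] by blast
  moreover have "N (1\<^sub>m n *\<^sub>v ?e) \<le> op_norm n N (1\<^sub>m n) * N ?e"
    by (rule op_norm_bound[OF N]) auto
  ultimately show ?thesis by simp
qed

section \<open>Perturbation estimates\<close>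

text \<open>The error \<open>e = y - x\<close> satisfies \<open>B e = (d - c) - G x - G e\<close>; applying the left inverse \<open>R\<close> and
  moving \<open>R (G e)\<close> to the left gives the factor \<open>1 - g \<parallel>R\<parallel>\<close>.\<close>

lemma perturbed_solution_bound:
  assumes N: "is_vec_norm n N" and n: "0 < n"
    and B: "B \<in> carrier_mat n n" and R: "R \<in> carrier_mat n n" and RB: "R * B = 1\<^sub>m n"
    and G: "G \<in> carrier_mat n n" and x: "x \<in> carrier_vec n" and y: "y \<in> carrier_vec n"
    and Bx: "B *\<^sub>v x = c" and BGy: "(B + G) *\<^sub>v y = d"
    and g: "op_norm n N G \<le> g"
  shows "(1 - g * op_norm n N R) * N (y - x) \<le> op_norm n N R * (N (d - c) + g * N x)"
proof -
  define e where "e = y - x"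
  have e: "e \<in> carrier_vec n" unfolding e_def using x y by simp
  have c: "c \<in> carrier_vec n" and d: "d \<in> carrier_vec n"
    using Bx BGy mult_mat_vec_carrier[OF B x] mult_mat_vec_carrier[OF add_carrier_mat[OF G] y] by auto
  have N0: "0 \<le> N v" if "v \<in> carrier_vec n" for v
    using vec_norm_nonneg[OF N that] .
  have GN: "N (G *\<^sub>v v) \<le> g * N v" if v: "v \<in> carrier_vec n" for v
    using op_norm_bound[OF N G v] mult_right_mono[OF g N0[OF v]] by simp
  have Be: "B *\<^sub>v e = (d - c) - (G *\<^sub>v x + G *\<^sub>v e)"
  proof -
    have "B *\<^sub>v e = B *\<^sub>v y - B *\<^sub>v x" and "G *\<^sub>v e = G *\<^sub>v y - G *\<^sub>v x"
      unfolding e_def using mult_minus_distrib_mat_vec[OF B y x] mult_minus_distrib_mat_vec[OF G y x] by auto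
    moreover have "d = B *\<^sub>v y + G *\<^sub>v y" using BGy add_mult_distrib_mat_vec[OF B G y] by simp
    ultimately show ?thesis using Bx B G x y by (intro eq_vecI) auto
  qed
  have "N e = N (R *\<^sub>v (B *\<^sub>v e))"
    using assoc_mult_mat_vec[OF R B e] RB e by simp
  also have "\<dots> \<le> op_norm n N R * N (B *\<^sub>v e)" using op_norm_bound[OF N R] B e by simp
  also have "N (B *\<^sub>v e) \<le> N (d - c) + N (G *\<^sub>v x + G *\<^sub>v e)"
    unfolding Be using G x e c d by (intro vec_norm_diff_triangle[OF N]) auto
  also have "N (G *\<^sub>v x + G *\<^sub>v e) \<le> N (G *\<^sub>v x) + N (G *\<^sub>v e)"
    using G x e by (intro vec_norm_triangle[OF N]) auto
  also have "\<dots> \<le> g * N x + g * N e" by (intro add_mono GN x e)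
  finally have "N e \<le> op_norm n N R * (N (d - c) + (g * N x + g * N e))"
    using op_norm_nonneg[OF N n R] by (simp add: mult_left_mono)
  then show ?thesis unfolding e_def[symmetric] by (simp add: algebra_simps)
qed

text \<open>The Neumann estimate: if \<open>w = R v\<close> then \<open>v = w + H w\<close>, so \<open>\<parallel>w\<parallel> \<le> \<parallel>v\<parallel> + \<mu> \<parallel>w\<parallel>\<close>.\<close>

lemma op_norm_inverse_one_plus_le:
  assumes N: "is_vec_norm n N" and n: "0 < n"
    and H: "H \<in> carrier_mat n n" and R: "R \<in> carrier_mat n n" and BR: "(1\<^sub>m n + H) * R = 1\<^sub>m n"
    and \<mu>: "op_norm n N H \<le> \<mu>" "\<mu> < 1"
  shows "op_norm n N R \<le> 1 / (1 - \<mu>)"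
proof (rule op_norm_least[OF N n])
  fix v :: "real Matrix.vec" assume v: "v \<in> carrier_vec n"
  define w where "w = R *\<^sub>v v"
  have w: "w \<in> carrier_vec n" unfolding w_def using R v by simp
  have Hw: "H *\<^sub>v w \<in> carrier_vec n" using H w by simp
  have "v = (1\<^sub>m n + H) *\<^sub>v w"
    unfolding w_def using assoc_mult_mat_vec[of "1\<^sub>m n + H" n n R n v] BR H R v by simp
  also have "\<dots> = w + H *\<^sub>v w" using add_mult_distrib_mat_vec[of "1\<^sub>m n" n n H w] H w by simp
  finally have "w = v - H *\<^sub>v w" using w H by (intro eq_vecI) auto
  then have "N w \<le> N v + N (H *\<^sub>v w)" using vec_norm_diff_triangle[OF N v Hw] by simp
  moreover have "0 \<le> N w" by (rule vec_norm_nonneg[OF N w])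
  then have "N (H *\<^sub>v w) \<le> \<mu> * N w"
    using op_norm_bound[OF N H w] mult_right_mono[OF \<mu>(1)] by force
  ultimately have "(1 - \<mu>) * N w \<le> N v" by (simp add: algebra_simps)
  then show "N (R *\<^sub>v v) \<le> 1 / (1 - \<mu>) * N v"
    unfolding w_def[symmetric] using \<mu>(2) by (simp add: field_simps)
qed

section \<open>The preconditioned matrix\<close>

lemma preconditioned_eq:
  assumes M: "M \<in> carrier_mat n n" and K: "K \<in> carrier_mat n n" and iM: "invertible_mat M"
  shows "1\<^sub>m n + mat_inv M * K = mat_inv M * (M + K)"
  using mult_add_distrib_mat[OF mat_inv(1)[OF M iM] M K] mat_inv(3)[OF M iM] by simp

lemma invertible_preconditioned:
  assumes M: "M \<in> carrier_mat n n" and A: "A \<in> carrier_mat n n"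
    and iM: "invertible_mat M" and iA: "invertible_mat A"
  shows "invertible_mat (mat_inv M * A)"
proof -
  note Mi = mat_inv[OF M iM] and Ai = mat_inv[OF A iA]
  have "(mat_inv M * A) * (mat_inv A * M) = mat_inv M * ((A * mat_inv A) * M)"
    using M A Mi(1) Ai(1) by (simp add: assoc_mult_mat[of _ n n _ n _ n])
  then have 1: "(mat_inv M * A) * (mat_inv A * M) = 1\<^sub>m n" using M Mi Ai by simp
  have "(mat_inv A * M) * (mat_inv M * A) = mat_inv A * ((M * mat_inv M) * A)"
    using M A Mi(1) Ai(1) by (simp add: assoc_mult_mat[of _ n n _ n _ n])
  then have 2: "(mat_inv A * M) * (mat_inv M * A) = 1\<^sub>m n" using A Mi Ai by simp
  show ?thesis
    unfolding invertible_mat_def inverts_mat_def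
    using 1 2 M A Mi(1) Ai(1) by (intro conjI exI[of _ "mat_inv A * M"]) auto
qed

theorem theorem3:
  fixes pE pc pF :: "real poly"
  shows "\<exists>q1 q2 :: real poly.
    \<forall>n u N A M K B Bh E F b c ch x xh \<delta>.
      0 < u \<and> u < 1 \<and> is_vec_norm n N \<and>
      M \<in> carrier_mat n n \<and> K \<in> carrier_mat n n \<and> A = M + K \<and>
      invertible_mat A \<and> invertible_mat M \<and>
      b \<in> carrier_vec n \<and> b \<noteq> 0\<^sub>v n \<and> x \<in> carrier_vec n \<and> A *\<^sub>v x = b \<and>
      B = 1\<^sub>m n + mat_inv M * K \<and> c = mat_inv M *\<^sub>v b \<and>
      E \<in> carrier_mat n n \<and> Bh = B + E \<and>
      op_norm n N E \<le> Ou pE n u * (1 + op_norm n N (mat_inv M) * op_norm n N K) \<and>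
      ch \<in> carrier_vec n \<and>
      N (ch - c) \<le> Ou pc n u * op_norm n N (mat_inv M) * N b \<and>
      F \<in> carrier_mat n n \<and> xh \<in> carrier_vec n \<and> (Bh + F) *\<^sub>v xh = ch \<and>
      op_norm n N F / op_norm n N Bh \<le> Ou pF n u \<and>
      \<delta> = (op_norm n N E + op_norm n N F) * op_norm n N (mat_inv B) \<and> \<delta> < 1
      \<longrightarrow>
      N (xh - x) / (op_norm n N (mat_inv A) * N b)
        \<le> Ou q1 n u * (cond_num n N B / (1 - \<delta>)) * (4 + op_norm n N K * N x / N b) \<and>
      (op_norm n N (mat_inv M) * op_norm n N K < 1 \<longrightarrow>
        N (xh - x) / (op_norm n N (mat_inv A) * N b)
          \<le> Ou q2 n u / ((1 - \<delta>) * (1 - op_norm n N (mat_inv M) * op_norm n N K)\<^sup>2))"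
proof -
  \<comment> \<open>The coefficient 2 of \<open>pE\<close> covers \<open>1 + 2 t \<le> 2 (4 + t)\<close> with \<open>t = \<parallel>K\<parallel> \<parallel>x\<parallel> / \<parallel>b\<parallel>\<close>, that of \<open>pF\<close> comes
    from \<open>\<parallel>B + E\<parallel> \<le> 2 \<parallel>B\<parallel>\<close>, and the 8 is the product of \<open>\<parallel>B\<parallel> \<le> 2\<close> and \<open>4 + t \<le> 4 / (1 - \<mu>)\<close>.\<close>
  let ?q1 = "pc + Polynomial.smult 2 pE + Polynomial.smult 2 pF"
  let ?q2 = "Polynomial.smult 8 ?q1"
  show ?thesis
  proof (rule exI[of _ ?q1], rule exI[of _ ?q2], intro allI impI, elim conjE)
    fix n u N and A M K B Bh E F :: "real Matrix.mat" and b c ch x xh :: "real Matrix.vec" and \<delta>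
    assume N: "is_vec_norm n N"
      and M: "M \<in> carrier_mat n n" and K: "K \<in> carrier_mat n n" and A_eq: "A = M + K"
      and iA: "invertible_mat A" and iM: "invertible_mat M"
      and b: "b \<in> carrier_vec n" "b \<noteq> 0\<^sub>v n" and x: "x \<in> carrier_vec n" and Ax: "A *\<^sub>v x = b"
      and B_eq: "B = 1\<^sub>m n + mat_inv M * K" and c_eq: "c = mat_inv M *\<^sub>v b"
      and E: "E \<in> carrier_mat n n" and Bh_eq: "Bh = B + E"
      and E_le: "op_norm n N E \<le> Ou pE n u * (1 + op_norm n N (mat_inv M) * op_norm n N K)"
      and c_le: "N (ch - c) \<le> Ou pc n u * op_norm n N (mat_inv M) * N b"
      and ch: "ch \<in> carrier_vec n"
      and F: "F \<in> carrier_mat n n" and xh: "xh \<in> carrier_vec n" and xh_eq: "(Bh + F) *\<^sub>v xh = ch"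
      and F_le: "op_norm n N F / op_norm n N Bh \<le> Ou pF n u"
      and \<delta>_eq: "\<delta> = (op_norm n N E + op_norm n N F) * op_norm n N (mat_inv B)" and \<delta>1: "\<delta> < 1"
    let ?no = "op_norm n N"
    have n: "0 < n" using b by (cases n) (auto intro: eq_vecI)
    have A: "A \<in> carrier_mat n n" using A_eq M K by simp
    note Mi = mat_inv[OF M iM] and Ai = mat_inv[OF A iA]
    have B_MA: "B = mat_inv M * A" unfolding B_eq A_eq by (rule preconditioned_eq[OF M K iM])
    have B: "B \<in> carrier_mat n n" unfolding B_MA using Mi(1) A by simp
    have iB: "invertible_mat B" unfolding B_MA by (rule invertible_preconditioned[OF M A iM iA])
    note Bi = mat_inv[OF B iB]
    have Minv_eq: "mat_inv M = B * mat_inv A"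
      unfolding B_MA using assoc_mult_mat[OF Mi(1) A Ai(1)] Ai(2) Mi(1) by simp
    have Ainv_eq: "mat_inv A = mat_inv B * mat_inv M"
      unfolding Minv_eq using assoc_mult_mat[OF Bi(1) B Ai(1)] Bi(3) Ai(1) by simp
    have MK: "mat_inv M * K \<in> carrier_mat n n" using Mi(1) K by simp

    define \<alpha> \<beta> \<gamma> m k e f X nb d where
      "\<alpha> = ?no (mat_inv A)" and "\<beta> = ?no B" and "\<gamma> = ?no (mat_inv B)" and "m = ?no (mat_inv M)"
      and "k = ?no K" and "e = ?no E" and "f = ?no F" and "X = N x" and "nb = N b" and "d = N (xh - x)"
    note defs = \<alpha>_def \<beta>_def \<gamma>_def m_def k_def e_def f_def X_def nb_def d_def
    define Pc PE PF where "Pc = Ou pc n u" and "PE = Ou pE n u" and "PF = Ou pF n u"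

    have nonneg: "0 \<le> \<alpha>" "0 \<le> \<beta>" "0 \<le> \<gamma>" "0 \<le> m" "0 \<le> k" "0 \<le> e" "0 \<le> f"
      unfolding defs using op_norm_nonneg[OF N n] A B K E F Ai(1) Bi(1) Mi(1) by blast+
    have X0: "0 \<le> X"
      unfolding defs by (rule vec_norm_nonneg[OF N x])
    have nb: "0 < nb"
      unfolding defs by (rule vec_norm_pos[OF N b])
    have "A *\<^sub>v 0\<^sub>v n = 0\<^sub>v n" using A by (intro eq_vecI) auto
    then have "x \<noteq> 0\<^sub>v n" using Ax b by auto
    then have X: "0 < X"
      unfolding defs by (rule vec_norm_pos[OF N x])
    have x_eq: "x = mat_inv A *\<^sub>v b"
      using assoc_mult_mat_vec[OF Ai(1) A x] Ai(3) x Ax by simp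
    have X_le: "X \<le> \<alpha> * nb"
      unfolding defs x_eq by (rule op_norm_bound[OF N Ai(1) b(1)])
    then have \<alpha>: "0 < \<alpha>" using X nb nonneg(1) by (cases "\<alpha> = 0") auto
    have m_le: "m \<le> \<beta> * \<alpha>"
      unfolding defs by (subst Minv_eq) (rule op_norm_mult_le[OF N n B Ai(1)])
    have \<alpha>_le: "\<alpha> \<le> \<gamma> * m"
      unfolding defs by (subst Ainv_eq) (rule op_norm_mult_le[OF N n Bi(1) Mi(1)])
    have m: "0 < m" using \<alpha> \<alpha>_le nonneg(4) by (cases "m = 0") auto
    have MK_le: "?no (mat_inv M * K) \<le> m * k"
      unfolding defs by (rule op_norm_mult_le[OF N n Mi(1) K])
    have BiB_le: "1 \<le> \<beta> * \<gamma>"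
      using op_norm_one_ge[OF N n] op_norm_mult_le[OF N n B Bi(1)] Bi(2) unfolding defs by simp

    have one_le: "1 \<le> \<beta> + m * k"
    proof -
      have "1\<^sub>m n = B - mat_inv M * K" unfolding B_eq using Mi(1) K by (intro eq_matI) auto
      then have "?no (1\<^sub>m n) \<le> \<beta> + ?no (mat_inv M * K)"
        unfolding \<beta>_def using op_norm_diff_le[OF N n B MK] by simp
      then show ?thesis using op_norm_one_ge[OF N n] MK_le by linarith
    qed

    \<comment> \<open>A polynomial may take negative values, but the error hypotheses force the values at this \<open>n\<close>
      to be nonnegative: a norm is at most the value times a positive number, or a quotient of norms
      is at most the value.\<close>
    have Pc0: "0 \<le> Pc"
    proof -
      have "c \<in> carrier_vec n" unfolding c_eq using Mi(1) b by simp
      then have "0 \<le> N (ch - c)" using ch by (intro vec_norm_nonneg[OF N]) simp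
      then have "0 \<le> Pc * (m * nb)" using c_le unfolding Pc_def defs by (simp add: mult.assoc)
      then show ?thesis using mult_pos_pos[OF m nb] by (simp add: zero_le_mult_iff)
    qed
    have PE0: "0 \<le> PE"
    proof -
      have "0 \<le> PE * (1 + m * k)" using E_le nonneg(6) unfolding PE_def defs by linarith
      moreover have "0 < 1 + m * k" using nonneg by (simp add: add_pos_nonneg)
      ultimately show ?thesis by (simp add: zero_le_mult_iff)
    qed
    have Bh: "Bh \<in> carrier_mat n n" unfolding Bh_eq using B E by simp
    have PF0: "0 \<le> PF"
      using order_trans[OF divide_nonneg_nonneg[OF _ op_norm_nonneg[OF N n Bh]] F_le] nonneg(7)
      unfolding PF_def f_def by simp

    have \<delta>_eq': "\<delta> = (e + f) * \<gamma>" unfolding \<delta>_eq defs ..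
    have \<gamma>: "0 < \<gamma>" using BiB_le nonneg(3) by (cases "\<gamma> = 0") auto
    have e_less: "e < \<beta>"
    proof -
      have "e * \<gamma> \<le> \<delta>" unfolding \<delta>_eq' using nonneg by (simp add: distrib_right)
      then have "e * \<gamma> < \<beta> * \<gamma>" using \<delta>1 BiB_le by linarith
      then show ?thesis using \<gamma> by simp
    qed
    have f_le: "f \<le> PF * (2 * \<beta>)"
    proof -
      \<comment> \<open>The quotient in the hypothesis on \<open>F\<close> would be 0 for \<open>B + E = 0\<close> and say nothing about \<open>F\<close>;
        here \<open>\<parallel>E\<parallel> < \<parallel>B\<parallel>\<close> excludes this.\<close>
      have "B = Bh - E" unfolding Bh_eq using B E by (intro eq_matI) auto
      then have "\<beta> \<le> ?no Bh + e"
        unfolding \<beta>_def e_def using op_norm_diff_le[OF N n Bh E] by simp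
      then have "0 < ?no Bh" using e_less by linarith
      then have "f \<le> PF * ?no Bh" using F_le unfolding PF_def f_def by (simp add: divide_le_eq)
      also have "?no Bh \<le> 2 * \<beta>"
        using op_norm_add_le[OF N n B E] e_less unfolding Bh_eq defs by linarith
      finally show ?thesis using PF0 by (simp add: mult_left_mono)
    qed

    have err: "(1 - \<delta>) * d \<le> \<gamma> * (N (ch - c) + (e + f) * X)"
    proof -
      have "B *\<^sub>v x = c"
        unfolding B_MA c_eq using assoc_mult_mat_vec[OF Mi(1) A x] Ax by simp
      moreover have "(B + (E + F)) *\<^sub>v xh = ch"
        using xh_eq assoc_add_mat[OF B E F] unfolding Bh_eq by simp
      moreover have "?no (E + F) \<le> e + f"
        unfolding defs by (rule op_norm_add_le[OF N n E F])
      ultimately show ?thesis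
        using perturbed_solution_bound[OF N n B Bi(1) Bi(3) add_carrier_mat[OF F] x xh]
        unfolding \<delta>_eq' \<gamma>_def X_def d_def by blast
    qed

    define t where "t = k * X / nb"
    have t0: "0 \<le> t" unfolding t_def using nonneg X0 nb by simp
    have tn: "k * X = t * nb" unfolding t_def using nb by simp
    \<comment> \<open>Each error source is measured against \<open>\<beta> \<alpha> nb = \<parallel>B\<parallel> \<parallel>A\<^sup>-\<^sup>1\<parallel> \<parallel>b\<parallel>\<close>.\<close>
    have c_part: "N (ch - c) \<le> Pc * (\<beta> * \<alpha> * nb)"
    proof -
      have "N (ch - c) \<le> Pc * (m * nb)" using c_le unfolding Pc_def defs by (simp add: mult.assoc)
      also have "\<dots> \<le> Pc * (\<beta> * \<alpha> * nb)"
        using m_le Pc0 nb by (intro mult_left_mono mult_right_mono) auto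
      finally show ?thesis .
    qed
    have e_part: "e * X \<le> PE * (\<beta> * \<alpha> * nb * (1 + 2 * t))"
    proof -
      have "(1 + m * k) * X \<le> (\<beta> + 2 * (m * k)) * X" using one_le X0 by (intro mult_right_mono) linarith+
      also have "\<dots> = \<beta> * X + 2 * (m * (t * nb))" unfolding tn[symmetric] by (simp add: algebra_simps)
      also have "\<dots> \<le> \<beta> * (\<alpha> * nb) + 2 * ((\<beta> * \<alpha>) * (t * nb))"
        using X_le m_le nonneg t0 nb by (intro add_mono mult_left_mono mult_right_mono) auto
      also have "\<dots> = \<beta> * \<alpha> * nb * (1 + 2 * t)" by (simp add: algebra_simps)
      finally have "PE * ((1 + m * k) * X) \<le> PE * (\<beta> * \<alpha> * nb * (1 + 2 * t))"
        using PE0 by (rule mult_left_mono)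
      moreover have "e * X \<le> (PE * (1 + m * k)) * X"
        using E_le X0 unfolding PE_def defs by (rule mult_right_mono)
      ultimately show ?thesis by (simp add: mult.assoc)
    qed
    have f_part: "f * X \<le> PF * (2 * (\<beta> * \<alpha> * nb))"
    proof -
      have "f * X \<le> (PF * (2 * \<beta>)) * (\<alpha> * nb)"
        using f_le X_le X0 PF0 nonneg by (intro mult_mono) auto
      then show ?thesis by (simp add: algebra_simps)
    qed
    have Q: "Ou ?q1 n u = Pc + 2 * PE + 2 * PF"
      unfolding Pc_def PE_def PF_def Ou_def by (simp add: algebra_simps)
    have Q0: "0 \<le> Ou ?q1 n u" unfolding Q using Pc0 PE0 PF0 by simp
    have total: "N (ch - c) + (e + f) * X \<le> Ou ?q1 n u * (\<beta> * \<alpha> * nb) * (4 + t)"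
    proof -
      have "N (ch - c) + (e + f) * X \<le> (\<beta> * \<alpha> * nb) * (Pc + PE * (1 + 2 * t) + PF * 2)"
        using c_part e_part f_part by (simp add: algebra_simps)
      also have "\<dots> \<le> (\<beta> * \<alpha> * nb) * ((Pc + 2 * PE + 2 * PF) * (4 + t))"
      proof (rule mult_left_mono)
        have "0 \<le> Pc * t" "0 \<le> PF * t" using Pc0 PF0 t0 by auto
        then show "Pc + PE * (1 + 2 * t) + PF * 2 \<le> (Pc + 2 * PE + 2 * PF) * (4 + t)"
          using Pc0 PE0 PF0 by (simp add: algebra_simps)
      qed (use nonneg nb in simp)
      finally show ?thesis unfolding Q by (simp add: algebra_simps)
    qed
    have "(1 - \<delta>) * d \<le> \<gamma> * (Ou ?q1 n u * (\<beta> * \<alpha> * nb) * (4 + t))"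
      using err mult_left_mono[OF total nonneg(3)] by linarith
    then have main: "d / (\<alpha> * nb) \<le> Ou ?q1 n u * ((\<beta> * \<gamma>) / (1 - \<delta>)) * (4 + t)"
      using \<alpha> nb \<delta>1 by (simp add: divide_simps mult_ac)
    have first: "N (xh - x) / (?no (mat_inv A) * N b)
        \<le> Ou ?q1 n u * (cond_num n N B / (1 - \<delta>)) * (4 + ?no K * N x / N b)"
      using main unfolding t_def defs cond_num_def .

    have second: "N (xh - x) / (?no (mat_inv A) * N b)
          \<le> Ou ?q2 n u / ((1 - \<delta>) * (1 - ?no (mat_inv M) * ?no K)\<^sup>2)"
      if "?no (mat_inv M) * ?no K < 1"
    proof -
      define \<mu> where "\<mu> = m * k"
      have \<mu>: "0 \<le> \<mu>" "\<mu> < 1" using that nonneg unfolding \<mu>_def defs by auto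
      have \<gamma>_le: "\<gamma> \<le> 1 / (1 - \<mu>)"
        unfolding \<gamma>_def
        by (rule op_norm_inverse_one_plus_le[OF N n MK Bi(1)])
           (use Bi(2) B_eq MK_le \<mu> in \<open>simp_all add: \<mu>_def\<close>)
      have "?no (1\<^sub>m n) \<le> 1"
        by (rule op_norm_least[OF N n]) simp
      then have \<beta>_le: "\<beta> \<le> 2"
        using op_norm_add_le[OF N n one_carrier_mat MK] MK_le \<mu> unfolding \<beta>_def B_eq \<mu>_def by linarith
      have "t \<le> k * \<alpha>"
        unfolding t_def using mult_left_mono[OF X_le nonneg(5)] nb by (simp add: divide_le_eq mult.assoc)
      also have "\<dots> \<le> k * (\<gamma> * m)" using \<alpha>_le nonneg(5) by (rule mult_left_mono)
      also have "\<dots> = \<gamma> * \<mu>" unfolding \<mu>_def by (simp add: mult_ac)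
      also have "\<dots> \<le> 1 / (1 - \<mu>) * \<mu>" using \<gamma>_le \<mu>(1) by (rule mult_right_mono)
      finally have "4 + t \<le> 4 + 1 / (1 - \<mu>) * \<mu>" by simp
      also have "\<dots> = (4 - 3 * \<mu>) / (1 - \<mu>)" using \<mu> by (simp add: field_simps)
      also have "\<dots> \<le> 4 / (1 - \<mu>)" using \<mu> by (intro divide_right_mono) auto
      finally have t_le: "4 + t \<le> 4 / (1 - \<mu>)" .
      have "Ou ?q1 n u * ((\<beta> * \<gamma>) / (1 - \<delta>)) * (4 + t)
          \<le> Ou ?q1 n u * ((2 * (1 / (1 - \<mu>))) / (1 - \<delta>)) * (4 / (1 - \<mu>))"
        using \<beta>_le \<gamma>_le nonneg t_le t0 Q0 \<delta>1 \<mu>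
        by (intro mult_mono mult_left_mono divide_right_mono divide_nonneg_nonneg mult_nonneg_nonneg) auto
      also have "\<dots> = (8 * Ou ?q1 n u) / ((1 - \<delta>) * (1 - \<mu>)\<^sup>2)"
        by (simp add: power2_eq_square mult_ac)
      also have "8 * Ou ?q1 n u = Ou ?q2 n u" unfolding Ou_def by (simp add: algebra_simps)
      finally show ?thesis using main unfolding \<mu>_def defs by linarith
    qed
    show "N (xh - x) / (?no (mat_inv A) * N b)
        \<le> Ou ?q1 n u * (cond_num n N B / (1 - \<delta>)) * (4 + ?no K * N x / N b) \<and>
      (?no (mat_inv M) * ?no K < 1 \<longrightarrow>
        N (xh - x) / (?no (mat_inv A) * N b)
          \<le> Ou ?q2 n u / ((1 - \<delta>) * (1 - ?no (mat_inv M) * ?no K)\<^sup>2))"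
      using first second by blast
  qed
qed

end
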